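(* Let $q\ge 0$ and $m\ge 1$ be integers, $\Gamma=\{-q,\dots,q\}$ and $N=2q+1$. Let $A\in\mathbb{C}^{m\times N}$ have entries $A_{l,k}=e^{2\pi \mathrm{i}kt_l}$ with $t_l=\frac{l-1}{m}$, $l=1,\dots,m$, $k\in\Gamma$. Write $N=am+b$ with $a=\lfloor N/m\rfloor$ and $0\le b<m$. Let $y=Ax+e$ and $\hat{x}=A^\dagger y$. Then $$\mathbb{E}\big[\|\hat{x}-x\|^2\big]=\begin{cases}\dfrac{N}{m^2}\,\epsilon^2, & m\ge N,\\[8pt] \dfrac{m+N-2b}{a(a+1)m^2}\,\epsilon^2+N-m, & m<N.\end{cases}$$
   Context: Observation model: $y=Ax+e$, where $x\in\mathbb{C}^N$ is a random vector with $\mathbb{E}[xx^*]=I_N$, and $e\in\mathbb{C}^m$ is noise with $\operatorname{Re}(e),\operatorname{Im}(e)\sim\mathcal{N}(0,\frac{\epsilon^2}{2m}I_m)$ independent of each other (so $\mathbb{E}[ee^*]=\frac{\epsilon^2}{m}I_m$), with $\epsilon>0$. The vectors $x$ and $e$ are independent. $A^\dagger$ denotes the Moore–Penrose inverse and $\|\cdot\|$ the Euclidean norm. The expectation is over $x$ and $e$. *)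

theory Defs
  imports
    "HOL-Probability.Probability"
    "Jordan_Normal_Form.Matrix"
    "Jordan_Normal_Form.Schur_Decomposition"
begin

unbundle no vec_syntax
hide_const (open) Finite_Cartesian_Product.vec Finite_Cartesian_Product.mat
  Finite_Cartesian_Product.row Finite_Cartesian_Product.column Finite_Cartesian_Product.vec_nth
hide_type (open) Finite_Cartesian_Product.vec
notation vec_index (infixl "$" 100)

definition l2_norm :: "complex vec \<Rightarrow> real" where
  "l2_norm v = L2_set (\<lambda>i. cmod (v $ i)) {..<dim_vec v}"

definition is_moore_penrose :: "complex mat \<Rightarrow> complex mat \<Rightarrow> bool" where
  "is_moore_penrose A X \<longleftrightarrow>
     X \<in> carrier_mat (dim_col A) (dim_row A) \<and>
     A * X * A = A \<and>
     X * A * X = X \<and>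
     mat_adjoint (A * X) = A * X \<and>
     mat_adjoint (X * A) = X * A"

definition moore_penrose :: "complex mat \<Rightarrow> complex mat" where
  "moore_penrose A = (THE X. is_moore_penrose A X)"

lemma mat_adjoint_index:
  fixes A :: "complex mat"
  assumes "i < dim_col A" "j < dim_row A"
  shows "mat_adjoint A $$ (i, j) = cnj (A $$ (j, i))"
  using assms unfolding mat_adjoint_def
  by (simp add: mat_of_rows_index conjugate_vec_def)

lemma mat_adjoint_dim [simp]:
  fixes A :: "complex mat"
  shows "dim_row (mat_adjoint A) = dim_col A" "dim_col (mat_adjoint A) = dim_row A"
  unfolding mat_adjoint_def by simp_all

lemma mat_adjoint_mult:
  fixes A B :: "complex mat"
  assumes "A \<in> carrier_mat n k" "B \<in> carrier_mat k p"
  shows "mat_adjoint (A * B) = mat_adjoint B * mat_adjoint A"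
  using assms
  by (intro eq_matI)
    (auto simp: mat_adjoint_index scalar_prod_def mult.commute)

lemma is_moore_penrose_unique:
  assumes X: "is_moore_penrose A X" and Y: "is_moore_penrose A Y"
  shows "X = Y"
proof -
  define n k where "n = dim_row A" and "k = dim_col A"
  have cA [simp]: "A \<in> carrier_mat n k" by (auto simp: n_def k_def)
  have cX [simp]: "X \<in> carrier_mat k n" and cY [simp]: "Y \<in> carrier_mat k n"
    using X Y by (auto simp: is_moore_penrose_def n_def k_def)
  have X1: "A * X * A = A" and X2: "X * A * X = X" and X3: "mat_adjoint (A * X) = A * X"
    and X4: "mat_adjoint (X * A) = X * A"
    using X by (auto simp: is_moore_penrose_def)
  have Y1: "A * Y * A = A" and Y2: "Y * A * Y = Y" and Y3: "mat_adjoint (A * Y) = A * Y"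
    and Y4: "mat_adjoint (Y * A) = Y * A"
    using Y by (auto simp: is_moore_penrose_def)
  have cAX: "A * X \<in> carrier_mat n n" and cAY: "A * Y \<in> carrier_mat n n"
    and cXA: "X * A \<in> carrier_mat k k" and cYA: "Y * A \<in> carrier_mat k k"
    by (auto intro: mult_carrier_mat[OF cA cX] mult_carrier_mat[OF cA cY]
        mult_carrier_mat[OF cX cA] mult_carrier_mat[OF cY cA])
  have "A * X = (A * Y) * (A * X)"
    using assoc_mult_mat[OF cAY cA cX] Y1 by simp
  also have "\<dots> = mat_adjoint ((A * X) * (A * Y))"
    using mat_adjoint_mult[OF cAX cAY] X3 Y3 by simp
  also have "(A * X) * (A * Y) = A * Y"
    using assoc_mult_mat[OF cAX cA cY] X1 by simp
  finally have AXY: "A * X = A * Y" using Y3 by simp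
  have "X * A = (X * A) * (Y * A)"
    using assoc_mult_mat[OF cXA cY cA] assoc_mult_mat[OF cX cA cY]
      assoc_mult_mat[OF cX cAY cA] Y1 by simp
  also have "\<dots> = mat_adjoint ((Y * A) * (X * A))"
    using mat_adjoint_mult[OF cYA cXA] X4 Y4 by simp
  also have "(Y * A) * (X * A) = Y * A"
    using assoc_mult_mat[OF cYA cX cA] assoc_mult_mat[OF cY cA cX]
      assoc_mult_mat[OF cY cAX cA] X1 by simp
  finally have XYA: "X * A = Y * A" using Y4 by simp
  have "X = X * A * Y"
    using X2 AXY assoc_mult_mat[OF cX cA cX] assoc_mult_mat[OF cX cA cY] by simp
  also have "\<dots> = Y" using XYA Y2 by simp
  finally show ?thesis .
qed

lemma moore_penrose_eqI:
  assumes "is_moore_penrose A X"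
  shows "moore_penrose A = X"
  unfolding moore_penrose_def
  using assms is_moore_penrose_unique by (intro the_equality)

(* Borel sigma-algebra on the vectors of dimension n, transported from the
   n-fold product of the Borel sigma-algebra on the scalars. *)
definition vec_borel :: "nat \<Rightarrow> 'b::topological_space vec measure" where
  "vec_borel n = vimage_algebra (carrier_vec n) (\<lambda>v. \<lambda>i\<in>{..<n}. v $ i)
     (PiM {..<n} (\<lambda>_. borel))"

(* The law N(0, v I_n), as the law of a vector of n independent N(0, v) coordinates;
   normal_density takes a standard deviation, whereas v is a variance. *)
definition isotropic_normal :: "nat \<Rightarrow> real \<Rightarrow> real vec measure" where
  "isotropic_normal n v =
     distr (PiM {..<n} (\<lambda>_. density lborel (normal_density 0 (sqrt v)))) (vec_borel n) (vec n)"

(* The matrix E[x x^*]. For measurable x, a nonzero diagonal entry forces the square of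
   that coordinate to be integrable, since the integral of a non-integrable function is 0. *)
definition second_moment :: "'w measure \<Rightarrow> nat \<Rightarrow> ('w \<Rightarrow> complex vec) \<Rightarrow> complex mat" where
  "second_moment M n x = mat n n (\<lambda>(i, j). LINT \<omega>|M. x \<omega> $ i * cnj (x \<omega> $ j))"

(* Rows l = 0, ..., m - 1 carry the sampling points l / m, and columns j = 0, ..., 2q
   carry the frequencies j - q, that is -q, ..., q. *)
definition fourier_matrix :: "nat \<Rightarrow> nat \<Rightarrow> complex mat" where
  "fourier_matrix q m = mat m (2 * q + 1) (\<lambda>(l, j).
     exp (2 * complex_of_real pi * \<i> * of_int (int j - int q) * of_real (real l / real m)))"

end

theory Submission
  imports Defs
begin

text \<open>
  Two columns of the sampled Fourier matrix \<open>A\<close> agree if their indices are congruent modulo \<open>m\<close>,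
  and are orthogonal otherwise. Hence, if \<open>n\<^sub>j\<close> is the size of the residue class of \<open>j\<close> among the
  \<open>N\<close> column indices, dividing row \<open>j\<close> of the adjoint of \<open>A\<close> by \<open>m n\<^sub>j\<close> gives the pseudoinverse
  \<open>P\<close>, and \<open>P A\<close> averages over the residue classes. In the error \<open>(P A - I) x + P e\<close> all
  coordinates of \<open>x\<close> and \<open>e\<close> are pairwise orthogonal (\<open>e\<close> has mean 0), so its second moment is the sum of the squared
  Hilbert-Schmidt norm of \<open>P A - I\<close>, which is \<open>\<Sum>\<^sub>j (1 - 1 / n\<^sub>j)\<close>, and of \<open>\<epsilon>\<^sup>2 / m\<close> times that of \<open>P\<close>,
  which is \<open>\<Sum>\<^sub>j 1 / (m n\<^sub>j\<^sup>2)\<close>. Finally \<open>b\<close> residue classes have size \<open>a + 1\<close> and \<open>m - b\<close> have size \<open>a\<close>.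
\<close>

section \<open>Residue classes of an initial segment\<close>

definition residue_count :: "nat \<Rightarrow> nat \<Rightarrow> nat \<Rightarrow> nat" where
  "residue_count m N j = card {k. k < N \<and> k mod m = j mod m}"

lemma residue_count_cong: "j mod m = k mod m \<Longrightarrow> residue_count m N j = residue_count m N k"
  by (simp add: residue_count_def)

lemma residue_count_pos: "j < N \<Longrightarrow> 0 < residue_count m N j"
  by (auto simp: residue_count_def card_gt_0_iff)

lemma residue_count_eq_1:
  assumes "j < N" "N \<le> m"
  shows "residue_count m N j = 1"
proof -
  have "{k. k < N \<and> k mod m = j mod m} = {j}"
    using assms by auto
  then show ?thesis
    by (simp add: residue_count_def)
qed

lemma sum_lessThan_add: "(\<Sum>j<m + n. f j) = (\<Sum>j<m. f j) + (\<Sum>j<n. f (m + j))"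
  for f :: "nat \<Rightarrow> 'a::comm_monoid_add"
  by (induction n) (simp_all add: ac_simps)

text \<open>Each induction step peels off the first \<open>m\<close> indices, on which
  \<open>j mod m\<close> runs through every residue once, and the shift by \<open>m\<close> leaves
  the remaining residues unchanged. The incomplete period of length \<open>b\<close> is the base
  case.\<close>

lemma sum_residues:
  fixes g :: "nat \<Rightarrow> 'a::comm_semiring_1"
  assumes "b \<le> m"
  shows "(\<Sum>j<a * m + b. g (j mod m)) = of_nat a * (\<Sum>r<m. g r) + (\<Sum>r<b. g (r mod m))"
proof (induction a)
  case (Suc a)
  have "(\<Sum>j<Suc a * m + b. g (j mod m)) = (\<Sum>j<m + (a * m + b). g (j mod m))"
    by (simp add: ac_simps)
  also have "\<dots> = (\<Sum>j<m. g (j mod m)) + (\<Sum>j<a * m + b. g (j mod m))"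
    by (simp add: sum_lessThan_add)
  finally show ?case
    using Suc by (simp add: algebra_simps)
qed simp

text \<open>Written as a sum of indicators, the count receives one from each of the \<open>a\<close>
  full periods, and one more from the incomplete period exactly when it reaches the residue of
  \<open>j\<close>.\<close>

lemma residue_count_eq:
  assumes "b < m"
  shows "residue_count m (a * m + b) j = a + of_bool (j mod m < b)"
proof -
  have m: "m > 0" using assms by simp
  have "residue_count m (a * m + b) j = (\<Sum>k<a * m + b. of_bool (k mod m = j mod m))"
    unfolding residue_count_def by (simp add: of_bool_def sum.If_cases Int_def)
  also have "\<dots> = a * (\<Sum>r<m. of_bool (r = j mod m)) + (\<Sum>r<b. of_bool (r mod m = j mod m))"
    using sum_residues[of b m "\<lambda>r. of_bool (r = j mod m) :: nat" a] assms by simp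
  also have "(\<Sum>r<m. of_bool (r = j mod m)) = (1::nat)"
    using m by (simp add: of_bool_def)
  also have "(\<Sum>r<b. of_bool (r mod m = j mod m)) = (\<Sum>r<b. of_bool (r = j mod m) :: nat)"
    using assms by (intro sum.cong) auto
  also have "\<dots> = of_bool (j mod m < b)"
    by (simp add: of_bool_def)
  finally show ?thesis by simp
qed

text \<open>A class of size \<open>c\<close> contributes \<open>c\<close> equal terms, hence
  \<open>1 / c ^ p\<close> in total, and there are \<open>m - b\<close> classes of size
  \<open>a\<close> and \<open>b\<close> of size \<open>a + 1\<close>. The exponent is kept general
  because the signal error needs \<open>p = 0\<close> and the noise error needs
  \<open>p = 1\<close>.\<close>

lemma sum_inverse_residue_count:
  fixes p :: nat
  assumes "b < m" "a > 0"
  shows "(\<Sum>j<a * m + b. 1 / real (residue_count m (a * m + b) j) ^ Suc p) =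
    real (m - b) / real a ^ p + real b / (real a + 1) ^ p"
proof -
  let ?g = "\<lambda>r. 1 / real (a + of_bool (r < b)) ^ Suc p"
  have low: "(\<Sum>r<b. ?g r) = real b / (real a + 1) ^ Suc p"
    by (simp add: add.commute)
  have "{..<m} = {..<b} \<union> {b..<m}" using assms by auto
  then have "(\<Sum>r<m. ?g r) = (\<Sum>r<b. ?g r) + (\<Sum>r=b..<m. ?g r)"
    by (simp only: sum.union_disjoint finite_lessThan finite_atLeastLessThan ivl_disj_int)
  also have "(\<Sum>r=b..<m. ?g r) = real (m - b) / real a ^ Suc p"
    by simp
  finally have all: "(\<Sum>r<m. ?g r) = real b / (real a + 1) ^ Suc p + real (m - b) / real a ^ Suc p"
    using low by simp
  have "(\<Sum>j<a * m + b. 1 / real (residue_count m (a * m + b) j) ^ Suc p) = (\<Sum>j<a * m + b. ?g (j mod m))"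
    using residue_count_eq[OF assms(1)] by simp
  also have "\<dots> = real a * (\<Sum>r<m. ?g r) + (\<Sum>r<b. ?g (r mod m))"
    using sum_residues[of b m ?g a] assms by simp
  also have "(\<Sum>r<b. ?g (r mod m)) = (\<Sum>r<b. ?g r)"
    using assms by (intro sum.cong) auto
  finally have "(\<Sum>j<a * m + b. 1 / real (residue_count m (a * m + b) j) ^ Suc p) =
      (real a + 1) * (real b / (real a + 1) ^ Suc p) + real a * (real (m - b) / real a ^ Suc p)"
    by (simp only: all low) (simp only: algebra_simps)
  also have "\<dots> = real (m - b) / real a ^ p + real b / (real a + 1) ^ p"
  proof -
    have "c * (t / c ^ Suc p) = t / c ^ p" if "c > 0" for c t :: real
      using that by simp
    from this[of "real a"] this[of "real a + 1"] show ?thesis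
      using assms by simp
  qed
  finally show ?thesis .
qed

section \<open>The pseudoinverse of the Fourier matrix\<close>

lemma fourier_matrix_carrier: "fourier_matrix q m \<in> carrier_mat m (2 * q + 1)"
  by (simp add: fourier_matrix_def)

text \<open>The frequency shift by \<open>q\<close> cancels in the difference, and the row index
  enters only as an exponent. Inner products of columns therefore become geometric sums.\<close>

lemma cnj_fourier_matrix_mult:
  assumes "l < m" "j < 2 * q + 1" "k < 2 * q + 1"
  shows "cnj (fourier_matrix q m $$ (l, j)) * fourier_matrix q m $$ (l, k) =
    exp (2 * complex_of_real pi * \<i> * of_int (int k - int j) / of_nat m) ^ l"
  using assms
  by (simp add: fourier_matrix_def exp_cnj flip: exp_add exp_of_nat_mult)
     (simp add: field_simps)

lemma norm_fourier_matrix: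
  assumes "l < m" "j < 2 * q + 1"
  shows "cmod (fourier_matrix q m $$ (l, j)) = 1"
  using assms by (simp add: fourier_matrix_def)

lemma mod_eq_iff_int_diff_dvd: "j mod m = k mod m \<longleftrightarrow> int m dvd int k - int j" for j k m :: nat
  by (metis mod_eq_dvd_iff of_nat_eq_iff zmod_int)

text \<open>The exponential of \<open>2 * pi * \<i> * t\<close> is 1 exactly for integer
  \<open>t\<close>; here \<open>t\<close> is \<open>(k - j) / m\<close>, so the condition is
  divisibility by \<open>m\<close>.\<close>

lemma root_of_unity_eq_1_iff:
  assumes "m > 0"
  shows "exp (2 * complex_of_real pi * \<i> * of_int (int k - int j) / of_nat m) = 1 \<longleftrightarrow>
    j mod m = k mod m"
proof -
  have "exp (2 * complex_of_real pi * \<i> * of_int (int k - int j) / of_nat m) = 1 \<longleftrightarrow>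
    (\<exists>n. real_of_int (int k - int j) / real m = of_int n)"
  proof -
    define t where "t = real_of_int (int k - int j) / real m"
    have "2 * complex_of_real pi * \<i> * of_int (int k - int j) / of_nat m = of_real (2 * pi * t) * \<i>"
      by (simp add: t_def)
    then have "exp (2 * complex_of_real pi * \<i> * of_int (int k - int j) / of_nat m) = 1 \<longleftrightarrow>
        (\<exists>n. 2 * pi * t = real_of_int (2 * n) * pi)"
      by (simp add: exp_eq_1)
    also have "\<dots> \<longleftrightarrow> (\<exists>n. t = of_int n)"
      by (intro ex_cong1) auto
    finally show ?thesis
      by (simp only: t_def)
  qed
  also have "\<dots> \<longleftrightarrow> (\<exists>n. int k - int j = int m * n)"
  proof -
    have "real_of_int (int k - int j) / real m = of_int n \<longleftrightarrow> int k - int j = int m * n" for n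
    proof -
      have "real_of_int (int k - int j) / real m = of_int n \<longleftrightarrow> real_of_int (int k - int j) = real_of_int (int m * n)"
        using assms by (simp add: field_simps)
      then show ?thesis by (simp only: of_int_eq_iff)
    qed
    then show ?thesis by simp
  qed
  finally show ?thesis
    by (simp add: mod_eq_iff_int_diff_dvd dvd_def)
qed

text \<open>The ratio \<open>?w\<close> of the geometric sum is an \<open>m\<close>-th root of
  unity, so the sum vanishes unless \<open>?w = 1\<close>, where all \<open>m\<close> terms are
  1.\<close>

lemma fourier_matrix_orthogonal:
  assumes "j < 2 * q + 1" "k < 2 * q + 1" "m > 0"
  shows "(\<Sum>l<m. cnj (fourier_matrix q m $$ (l, j)) * fourier_matrix q m $$ (l, k)) =
    (if j mod m = k mod m then of_nat m else 0)"
proof -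
  let ?w = "exp (2 * complex_of_real pi * \<i> * of_int (int k - int j) / of_nat m)"
  have "?w ^ m = exp (of_real (2 * of_int (int k - int j) * pi) * \<i>)"
    using assms by (simp flip: exp_of_nat_mult) (simp add: algebra_simps)
  also have "\<dots> = 1"
    by (rule exp_integer_2pi) auto
  finally have "?w ^ m = 1" .
  then have "(\<Sum>l<m. ?w ^ l) = (if ?w = 1 then of_nat m else 0)"
    by (simp add: geometric_sum)
  then show ?thesis
    using assms by (simp add: cnj_fourier_matrix_mult root_of_unity_eq_1_iff del: of_int_diff)
qed

text \<open>For congruent indices the root of unity is 1, so \<open>cnj (?f j) * ?f k = 1\<close>.
  Multiplying by the unimodular \<open>?f j\<close> gives the equality.\<close>

lemma fourier_matrix_periodic:
  assumes "l < m" "j < 2 * q + 1" "k < 2 * q + 1" "j mod m = k mod m"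
  shows "fourier_matrix q m $$ (l, j) = fourier_matrix q m $$ (l, k)"
proof -
  let ?f = "\<lambda>j. fourier_matrix q m $$ (l, j)"
  have one: "cnj (?f j) * ?f k = 1"
    using assms root_of_unity_eq_1_iff[of m k j] by (simp add: cnj_fourier_matrix_mult)
  have "?f j * cnj (?f j) = 1"
    using norm_fourier_matrix[OF assms(1,2)] by (simp add: complex_norm_square[symmetric])
  then have "?f k = ?f j * (cnj (?f j) * ?f k)" by (simp add: mult.assoc[symmetric])
  with one show ?thesis by simp
qed

text \<open>Grouped by residues, the Gram matrix of the columns is block diagonal with blocks
  \<open>m * J\<close>, where \<open>J\<close> is the all-ones matrix of size \<open>n\<close>. The
  pseudoinverse of such a block is \<open>J / (m * n^2)\<close>. On the adjoint of the Fourier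
  matrix, whose rows agree within a class, \<open>J\<close> acts as multiplication by
  \<open>n\<close>, which leaves the factor \<open>1 / (m * n)\<close>.\<close>

definition fourier_pinv :: "nat \<Rightarrow> nat \<Rightarrow> complex mat" where
  "fourier_pinv q m = mat (2 * q + 1) m (\<lambda>(j, l).
     cnj (fourier_matrix q m $$ (l, j)) / of_nat (m * residue_count m (2 * q + 1) j))"

lemma fourier_pinv_carrier: "fourier_pinv q m \<in> carrier_mat (2 * q + 1) m"
  by (simp add: fourier_pinv_def)

lemma fourier_pinv_mult:
  assumes "m > 0"
  shows "fourier_pinv q m * fourier_matrix q m =
    mat (2 * q + 1) (2 * q + 1) (\<lambda>(j, k).
      if j mod m = k mod m then 1 / of_nat (residue_count m (2 * q + 1) j) else 0)"
proof (intro eq_matI)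
  fix j k assume "j < dim_row (mat (2 * q + 1) (2 * q + 1) (\<lambda>(j, k).
      if j mod m = k mod m then 1 / of_nat (residue_count m (2 * q + 1) j) else 0 :: complex))"
    "k < dim_col (mat (2 * q + 1) (2 * q + 1) (\<lambda>(j, k).
      if j mod m = k mod m then 1 / of_nat (residue_count m (2 * q + 1) j) else 0 :: complex))"
  then have jk: "j < 2 * q + 1" "k < 2 * q + 1" by auto
  let ?n = "of_nat (residue_count m (2 * q + 1) j) :: complex"
  have "(fourier_pinv q m * fourier_matrix q m) $$ (j, k) =
    (\<Sum>l<m. cnj (fourier_matrix q m $$ (l, j)) / (of_nat m * ?n) * fourier_matrix q m $$ (l, k))"
    using jk carrier_matD[OF fourier_matrix_carrier[of q m]]
    by (simp add: fourier_pinv_def scalar_prod_def lessThan_atLeast0)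
  also have "\<dots> = (\<Sum>l<m. cnj (fourier_matrix q m $$ (l, j)) * fourier_matrix q m $$ (l, k)) / (of_nat m * ?n)"
    by (simp add: sum_divide_distrib)
  also have "\<dots> = (if j mod m = k mod m then 1 / ?n else 0)"
    using fourier_matrix_orthogonal[OF jk assms] assms by simp
  finally show "(fourier_pinv q m * fourier_matrix q m) $$ (j, k) =
    mat (2 * q + 1) (2 * q + 1) (\<lambda>(j, k).
      if j mod m = k mod m then 1 / of_nat (residue_count m (2 * q + 1) j) else 0) $$ (j, k)"
    using jk by simp
qed (auto simp: fourier_pinv_def fourier_matrix_def)

text \<open>All terms that survive equal \<open>f j / n\<close>, and there are \<open>n\<close> of
  them. With \<open>f\<close> a row of the Fourier matrix or a column of its pseudoinverse, this
  yields the first two Penrose equations.\<close>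

lemma sum_residue_class_average:
  fixes f :: "nat \<Rightarrow> complex"
  assumes "j < N" and "\<And>k. k < N \<Longrightarrow> k mod m = j mod m \<Longrightarrow> f k = f j"
  shows "(\<Sum>k<N. if k mod m = j mod m then f k / of_nat (residue_count m N k) else 0) = f j"
proof -
  have "(\<Sum>k<N. if k mod m = j mod m then f k / of_nat (residue_count m N k) else 0) =
    (\<Sum>k | k < N \<and> k mod m = j mod m. f k / of_nat (residue_count m N k))"
    by (simp add: sum.If_cases Int_def)
  also have "\<dots> = (\<Sum>k | k < N \<and> k mod m = j mod m. f j / of_nat (residue_count m N j))"
    using assms(2) by (intro sum.cong arg_cong2[where f = "(/)"] arg_cong[where f = of_nat] residue_count_cong) auto
  also have "\<dots> = of_nat (residue_count m N j) * (f j / of_nat (residue_count m N j))"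
    by (simp add: residue_count_def)
  also have "\<dots> = f j"
    using residue_count_pos[OF assms(1), of m] by simp
  finally show ?thesis .
qed

lemma is_moore_penrose_fourier_pinv:
  assumes "m > 0"
  shows "is_moore_penrose (fourier_matrix q m) (fourier_pinv q m)"
proof -
  let ?A = "fourier_matrix q m" and ?P = "fourier_pinv q m" and ?N = "2 * q + 1"
  note dims [simp] = carrier_matD[OF fourier_matrix_carrier[of q m]]
    carrier_matD[OF fourier_pinv_carrier[of q m]]
  let ?n = "residue_count m ?N"
  have "?A * (?P * ?A) = ?A"
  proof (intro eq_matI)
    fix l j assume lj: "l < dim_row ?A" "j < dim_col ?A"
    have "(?A * (?P * ?A)) $$ (l, j) =
      (\<Sum>k<?N. if k mod m = j mod m then ?A $$ (l, k) / of_nat (?n k) else 0)"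
      using lj by (auto simp: fourier_pinv_mult[OF assms] scalar_prod_def lessThan_atLeast0 intro!: sum.cong)
    also have "\<dots> = ?A $$ (l, j)"
      using lj by (intro sum_residue_class_average) (auto intro: fourier_matrix_periodic)
    finally show "(?A * (?P * ?A)) $$ (l, j) = ?A $$ (l, j)" .
  qed (auto)
  moreover have "?P * ?A * ?P = ?P"
  proof (intro eq_matI)
    fix j l assume jl: "j < dim_row ?P" "l < dim_col ?P"
    have "(?P * ?A * ?P) $$ (j, l) =
      (\<Sum>k<?N. if k mod m = j mod m then ?P $$ (k, l) / of_nat (?n k) else 0)"
    proof -
      have n: "?n j = ?n k" if "j mod m = k mod m" for k
        using that by (rule residue_count_cong)
      have "(?P * ?A * ?P) $$ (j, l) =
          (\<Sum>k<?N. (if j mod m = k mod m then 1 / of_nat (?n j) else 0) * ?P $$ (k, l))"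
        using jl by (simp add: fourier_pinv_mult[OF assms] scalar_prod_def lessThan_atLeast0)
      also have "\<dots> = (\<Sum>k<?N. if k mod m = j mod m then ?P $$ (k, l) / of_nat (?n k) else 0)"
      proof (intro sum.cong refl)
        fix k
        show "(if j mod m = k mod m then 1 / of_nat (?n j) else 0) * ?P $$ (k, l) =
            (if k mod m = j mod m then ?P $$ (k, l) / of_nat (?n k) else 0)"
          using n[of k] by (cases "k mod m = j mod m") simp_all
      qed
      finally show ?thesis .
    qed
    also have "\<dots> = ?P $$ (j, l)"
    proof (rule sum_residue_class_average)
      fix k assume k: "k < ?N" "k mod m = j mod m"
      then have "?n k = ?n j" "?A $$ (l, k) = ?A $$ (l, j)"
        using jl by (auto intro: residue_count_cong fourier_matrix_periodic)
      then show "?P $$ (k, l) = ?P $$ (j, l)"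
        using jl k by (simp add: fourier_pinv_def)
    qed (use jl in auto)
    finally show "(?P * ?A * ?P) $$ (j, l) = ?P $$ (j, l)" .
  qed auto
  \<comment> \<open>The product is a sum of rank-one matrices, each a column of \<open>?A\<close>
    times its own adjoint, with real weights.\<close>
  moreover have "mat_adjoint (?A * ?P) = ?A * ?P"
    by (intro eq_matI)
      (simp_all add: mat_adjoint_index scalar_prod_def fourier_pinv_def mult.commute)
  \<comment> \<open>The entries are real, and symmetric because congruent indices have the same
    class size.\<close>
  moreover have "mat_adjoint (?P * ?A) = ?P * ?A"
    by (intro eq_matI)
      (auto simp: mat_adjoint_index fourier_pinv_mult[OF assms] intro: residue_count_cong)
  moreover have "?A * ?P * ?A = ?A * (?P * ?A)"
    by (rule assoc_mult_mat[OF fourier_matrix_carrier fourier_pinv_carrier fourier_matrix_carrier])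
  ultimately show ?thesis
    using fourier_pinv_carrier[of q m] by (simp add: is_moore_penrose_def)
qed

section \<open>Moments of random vectors\<close>

lemma space_vec_borel [simp]: "space (vec_borel n) = carrier_vec n"
  by (simp add: vec_borel_def)

lemma measurable_vec_index:
  assumes "i < n"
  shows "(\<lambda>v. v $ i) \<in> vec_borel n \<rightarrow>\<^sub>M (borel :: 'a::topological_space measure)"
proof -
  have "(\<lambda>v. \<lambda>i\<in>{..<n}. v $ i) \<in> vec_borel n \<rightarrow>\<^sub>M Pi\<^sub>M {..<n} (\<lambda>_. borel :: 'a measure)"
    unfolding vec_borel_def by (rule measurable_vimage_algebra1) (auto simp: space_PiM)
  from measurable_compose[OF this measurable_component_singleton[of i]] show ?thesis
    using assms by simp
qed

lemma borel_measurable_cnj [measurable (raw)]: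
  "f \<in> borel_measurable M \<Longrightarrow> (\<lambda>x. cnj (f x)) \<in> borel_measurable M"
  by (rule measurable_compose[OF _ borel_measurable_continuous_onI]) (auto intro: continuous_intros)

text \<open>Since \<open>vec_borel\<close> is a pullback, it suffices to check measurability after
  passing to coordinates, where \<open>vec n\<close> becomes a restriction map.\<close>

lemma measurable_vec:
  "vec n \<in> Pi\<^sub>M {..<n} (\<lambda>_. borel :: 'a::topological_space measure) \<rightarrow>\<^sub>M vec_borel n"
  unfolding vec_borel_def
proof (rule measurable_vimage_algebra2)
  have "(\<lambda>x. \<lambda>i\<in>{..<n}. x i) \<in>
      Pi\<^sub>M {..<n} (\<lambda>_. borel :: 'a measure) \<rightarrow>\<^sub>M Pi\<^sub>M {..<n} (\<lambda>_. borel)"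
    by (intro measurable_restrict measurable_component_singleton)
  also have "(\<lambda>x. \<lambda>i\<in>{..<n}. x i) = (\<lambda>x :: nat \<Rightarrow> 'a. \<lambda>i\<in>{..<n}. vec n x $ i)"
    by (intro ext) (auto simp: restrict_def)
  finally show "(\<lambda>x. \<lambda>i\<in>{..<n}. vec n x $ i) \<in>
      Pi\<^sub>M {..<n} (\<lambda>_. borel :: 'a measure) \<rightarrow>\<^sub>M Pi\<^sub>M {..<n} (\<lambda>_. borel)" .
qed auto

section \<open>Moments of the isotropic real normal law\<close>

lemma normal_moment_le_2:
  fixes v :: real
  assumes "v > 0" "p \<le> 2"
  shows "has_bochner_integral (density lborel (normal_density 0 (sqrt v))) (\<lambda>t. t ^ p)
    (if p = 0 then 1 else if p = 1 then 0 else v)"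
proof (rule has_bochner_integral_density)
  have s: "sqrt v > 0" using assms by simp
  consider "p = 0" | "p = 1" | "p = 2" using assms(2) by linarith
  then show "has_bochner_integral lborel (\<lambda>t. normal_density 0 (sqrt v) t *\<^sub>R t ^ p)
    (if p = 0 then 1 else if p = 1 then 0 else v)"
  proof cases
    case 1
    then show ?thesis using normal_moment_even[OF s, of 0 0] by simp
  next
    case 2
    then show ?thesis using normal_moment_nz_1[OF s, of 0] by simp
  next
    case 3
    then show ?thesis using normal_moment_even[OF s, of 0 1] assms(1) by (simp add: fact_numeral)
  qed
qed auto

text \<open>Under the product measure the integral of a monomial is the product of one-dimensional
  moments. Means and covariances are then special choices of the exponents \<open>c\<close>.\<close>

lemma isotropic_normal_monomial:
  fixes v :: real
  assumes "v > 0" "\<And>i. i < n \<Longrightarrow> c i \<le> 2"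
  shows "has_bochner_integral (isotropic_normal n v) (\<lambda>u. \<Prod>i<n. u $ i ^ c i)
    (\<Prod>i<n. if c i = 0 then 1 else if c i = 1 then 0 else v)"
  unfolding isotropic_normal_def
proof (rule has_bochner_integral_distr)
  let ?D = "density lborel (normal_density 0 (sqrt v))"
  interpret D: prob_space ?D
    using assms by (intro prob_space_normal_density) simp
  interpret product_sigma_finite "\<lambda>_ :: nat. ?D"
    by unfold_locales
  show "(\<lambda>u :: real vec. \<Prod>i<n. u $ i ^ c i) \<in> borel_measurable (vec_borel n)"
    by (intro borel_measurable_prod borel_measurable_power measurable_vec_index) simp
  have "sets (Pi\<^sub>M {..<n} (\<lambda>_. ?D)) = sets (Pi\<^sub>M {..<n} (\<lambda>_. borel))"
    by (intro sets_PiM_cong) auto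
  then show "vec n \<in> Pi\<^sub>M {..<n} (\<lambda>_. ?D) \<rightarrow>\<^sub>M vec_borel n"
    using measurable_vec[of n, where 'a = real] by (simp cong: measurable_cong_sets)
  have mom: "integrable ?D (\<lambda>t. t ^ c i)"
    "integral\<^sup>L ?D (\<lambda>t. t ^ c i) = (if c i = 0 then 1 else if c i = 1 then 0 else v)" if "i < n" for i
    using normal_moment_le_2[OF assms(1) assms(2)[OF that]] by (simp_all only: has_bochner_integral_iff)
  have "has_bochner_integral (Pi\<^sub>M {..<n} (\<lambda>_. ?D)) (\<lambda>x. \<Prod>i<n. x i ^ c i)
    (\<Prod>i<n. if c i = 0 then 1 else if c i = 1 then 0 else v)"
    unfolding has_bochner_integral_iff
  proof
    show "integrable (Pi\<^sub>M {..<n} (\<lambda>_. ?D)) (\<lambda>x. \<Prod>i<n. x i ^ c i)"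
      by (intro product_integrable_prod[where f = "\<lambda>i t. t ^ c i"] mom) auto
    have "integral\<^sup>L (Pi\<^sub>M {..<n} (\<lambda>_. ?D)) (\<lambda>x. \<Prod>i<n. x i ^ c i) = (\<Prod>i<n. integral\<^sup>L ?D (\<lambda>t. t ^ c i))"
      by (intro product_integral_prod[where f = "\<lambda>i t. t ^ c i"] mom) auto
    also have "\<dots> = (\<Prod>i<n. if c i = 0 then 1 else if c i = 1 then 0 else v)"
      by (intro prod.cong mom(2)) auto
    finally show "integral\<^sup>L (Pi\<^sub>M {..<n} (\<lambda>_. ?D)) (\<lambda>x. \<Prod>i<n. x i ^ c i) =
      (\<Prod>i<n. if c i = 0 then 1 else if c i = 1 then 0 else v)" .
  qed
  then show "has_bochner_integral (Pi\<^sub>M {..<n} (\<lambda>_. ?D)) (\<lambda>x. \<Prod>i<n. vec n x $ i ^ c i)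
    (\<Prod>i<n. if c i = 0 then 1 else if c i = 1 then 0 else v)"
    by (rule has_bochner_integral_cong[THEN iffD1, rotated -1]) auto
qed

lemma prod_power_of_bool:
  fixes f :: "nat \<Rightarrow> 'a::comm_semiring_1"
  assumes "k < n"
  shows "(\<Prod>i<n. f i ^ of_bool (i = k)) = f k"
proof -
  have "(\<Prod>i<n. f i ^ of_bool (i = k)) = (\<Prod>i<n. if i = k then f i else 1)"
    by (intro prod.cong) auto
  also have "\<dots> = f k" using assms by simp
  finally show ?thesis .
qed

lemma isotropic_normal_mean:
  assumes "v > 0" "k < n"
  shows "has_bochner_integral (isotropic_normal n v) (\<lambda>u. u $ k) 0"
proof -
  let ?c = "\<lambda>i. of_bool (i = k) :: nat"
  let ?v = "\<Prod>i<n. if ?c i = 0 then 1 else if ?c i = 1 then 0 else v"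
  have "has_bochner_integral (isotropic_normal n v) (\<lambda>u. \<Prod>i<n. u $ i ^ ?c i) ?v"
    by (intro isotropic_normal_monomial assms) auto
  also have "(\<lambda>u :: real vec. \<Prod>i<n. u $ i ^ ?c i) = (\<lambda>u. u $ k)"
    using assms by (simp only: prod_power_of_bool)
  also have "?v = 0"
    using assms by (intro prod_zero) auto
  finally show ?thesis .
qed

lemma isotropic_normal_covariance:
  assumes "v > 0" "k < n" "l < n"
  shows "has_bochner_integral (isotropic_normal n v) (\<lambda>u. u $ k * u $ l) (if k = l then v else 0)"
proof -
  \<comment> \<open>For \<open>k = l\<close> the only nonzero exponent is 2, giving the factor
    \<open>v\<close>; otherwise two exponents are 1, and a first moment 0 kills the product.\<close>
  let ?c = "\<lambda>i. of_bool (i = k) + of_bool (i = l) :: nat"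
  let ?v = "\<Prod>i<n. if ?c i = 0 then 1 else if ?c i = 1 then 0 else v"
  have "has_bochner_integral (isotropic_normal n v) (\<lambda>u. \<Prod>i<n. u $ i ^ ?c i) ?v"
    by (intro isotropic_normal_monomial assms) auto
  also have "(\<lambda>u :: real vec. \<Prod>i<n. u $ i ^ ?c i) = (\<lambda>u. u $ k * u $ l)"
    using assms by (simp only: power_add prod.distrib prod_power_of_bool)
  also have "?v = (if k = l then v else 0)"
  proof (cases "k = l")
    case True
    then have "?v = (\<Prod>i<n. if i = k then v else 1)"
      by (intro prod.cong) auto
    then show ?thesis using True assms by simp
  next
    case False
    then have "?v = 0"
      using assms by (intro prod_zero) auto
    then show ?thesis using False by simp
  qed
  finally show ?thesis .
qed

text \<open>This is Pythagoras in L2: expanding the square into a double sum, only the diagonal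
  terms have nonzero integral.\<close>

lemma has_bochner_integral_norm_square_orthogonal:
  fixes z :: "'i \<Rightarrow> 'w \<Rightarrow> complex" and d :: "'i \<Rightarrow> real"
  assumes "finite I"
    and z: "\<And>i j. i \<in> I \<Longrightarrow> j \<in> I \<Longrightarrow>
      has_bochner_integral M (\<lambda>\<omega>. z i \<omega> * cnj (z j \<omega>)) (if i = j then of_real (d i) else 0)"
  shows "has_bochner_integral M (\<lambda>\<omega>. (cmod (\<Sum>i\<in>I. c i * z i \<omega>))\<^sup>2) (\<Sum>i\<in>I. (cmod (c i))\<^sup>2 * d i)"
proof -
  have "has_bochner_integral M
      (\<lambda>\<omega>. \<Sum>i\<in>I. \<Sum>j\<in>I. (c i * cnj (c j)) * (z i \<omega> * cnj (z j \<omega>)))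
      (\<Sum>i\<in>I. \<Sum>j\<in>I. (c i * cnj (c j)) * (if i = j then of_real (d i) else 0))"
    by (intro has_bochner_integral_sum has_bochner_integral_mult_right z)
  also have "(\<Sum>i\<in>I. \<Sum>j\<in>I. (c i * cnj (c j)) * (if i = j then of_real (d i) else 0)) =
      of_real (\<Sum>i\<in>I. (cmod (c i))\<^sup>2 * d i)"
    using \<open>finite I\<close> by (simp add: if_distrib[of "(*) _"] flip: complex_norm_square cong: if_cong)
  also have "(\<lambda>\<omega>. \<Sum>i\<in>I. \<Sum>j\<in>I. (c i * cnj (c j)) * (z i \<omega> * cnj (z j \<omega>))) =
      (\<lambda>\<omega>. of_real ((cmod (\<Sum>i\<in>I. c i * z i \<omega>))\<^sup>2))"
    unfolding complex_norm_square cnj_sum sum_product complex_cnj_mult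
    by (intro ext sum.cong refl) (simp add: mult_ac)
  \<comment> \<open>The expansion is an identity of complex-valued integrals; taking real parts
    returns to the real-valued squared norm.\<close>
  finally have "has_bochner_integral M (\<lambda>\<omega>. Re (of_real ((cmod (\<Sum>i\<in>I. c i * z i \<omega>))\<^sup>2)))
      (Re (of_real (\<Sum>i\<in>I. (cmod (c i))\<^sup>2 * d i)))"
    by (rule has_bochner_integral_bounded_linear[OF bounded_linear_Re])
  then show ?thesis by (simp only: Re_complex_of_real)
qed

lemma l2_norm_power2: "(l2_norm v)\<^sup>2 = (\<Sum>i<dim_vec v. (cmod (v $ i))\<^sup>2)"
  by (simp add: l2_norm_def L2_set_def sum_nonneg)

section \<open>Second moments of the signal, the noise and their linear combinations\<close>

context prob_space
begin

text \<open>The bound \<open>t \<le> 1 + t^2\<close> suffices because constants are integrable on a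
  probability space.\<close>

lemma integrable_of_square_integrable:
  fixes X :: "'a \<Rightarrow> complex"
  assumes [measurable]: "X \<in> borel_measurable M" and "integrable M (\<lambda>\<omega>. (cmod (X \<omega>))\<^sup>2)"
  shows "integrable M X"
proof (rule Bochner_Integration.integrable_bound)
  show "integrable M (\<lambda>\<omega>. 1 + (cmod (X \<omega>))\<^sup>2)"
    using assms(2) by simp
  have "t \<le> 1 + t\<^sup>2" for t :: real
    using zero_le_power2[of "t - 1"] zero_le_power2[of t] unfolding power2_diff power_one by linarith
  then show "AE \<omega> in M. norm (X \<omega>) \<le> norm (1 + (cmod (X \<omega>))\<^sup>2)"
    by (simp add: abs_of_nonneg)
qed measurable

lemma integrable_mult_of_square_integrable:
  fixes X Y :: "'a \<Rightarrow> complex"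
  assumes [measurable]: "X \<in> borel_measurable M" "Y \<in> borel_measurable M"
    and "integrable M (\<lambda>\<omega>. (cmod (X \<omega>))\<^sup>2)" "integrable M (\<lambda>\<omega>. (cmod (Y \<omega>))\<^sup>2)"
  shows "integrable M (\<lambda>\<omega>. X \<omega> * cnj (Y \<omega>))"
proof (rule Bochner_Integration.integrable_bound)
  show "integrable M (\<lambda>\<omega>. (cmod (X \<omega>))\<^sup>2 + (cmod (Y \<omega>))\<^sup>2)"
    using assms(3,4) by simp
  have "s * t \<le> s\<^sup>2 + t\<^sup>2" if "s \<ge> 0" "t \<ge> 0" for s t :: real
    using zero_le_power2[of "s - t"] mult_nonneg_nonneg[OF that] unfolding power2_diff by linarith
  then show "AE \<omega> in M. norm (X \<omega> * cnj (Y \<omega>)) \<le> norm ((cmod (X \<omega>))\<^sup>2 + (cmod (Y \<omega>))\<^sup>2)"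
    by (simp add: norm_mult abs_of_nonneg)
qed measurable

text \<open>The matrix identity fixes only values of integrals, and an off-diagonal 0 alone says
  nothing about integrability. The diagonal gives square integrability of each coordinate, which
  dominates the mixed products.\<close>

lemma second_moment_oneD:
  assumes x: "x \<in> M \<rightarrow>\<^sub>M vec_borel n" and one: "second_moment M n x = 1\<^sub>m n" and "i < n"
  shows "integrable M (\<lambda>\<omega>. (cmod (x \<omega> $ i))\<^sup>2)" and "integrable M (\<lambda>\<omega>. x \<omega> $ i)"
    and "j < n \<Longrightarrow>
      has_bochner_integral M (\<lambda>\<omega>. x \<omega> $ i * cnj (x \<omega> $ j)) (if i = j then of_real 1 else 0)"
proof -
  have meas: "(\<lambda>\<omega>. x \<omega> $ k) \<in> borel_measurable M" if "k < n" for k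
    using measurable_compose[OF x measurable_vec_index[OF that]] .
  have int: "(LINT \<omega>|M. x \<omega> $ k * cnj (x \<omega> $ l)) = (if k = l then 1 else 0)" if "k < n" "l < n" for k l
    using arg_cong[OF one, of "\<lambda>B. B $$ (k, l)"] that by (simp add: second_moment_def)
  have sq: "integrable M (\<lambda>\<omega>. (cmod (x \<omega> $ k))\<^sup>2)" if "k < n" for k
  proof -
    \<comment> \<open>a non-integrable function would have integral 0, not 1\<close>
    have "integrable M (\<lambda>\<omega>. x \<omega> $ k * cnj (x \<omega> $ k))"
      using int[OF that that] not_integrable_integral_eq by fastforce
    from integrable_norm[OF this] show ?thesis
      by (simp add: norm_mult power2_eq_square)
  qed
  show "integrable M (\<lambda>\<omega>. (cmod (x \<omega> $ i))\<^sup>2)"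
    using sq assms(3) .
  show "integrable M (\<lambda>\<omega>. x \<omega> $ i)"
    using assms(3) by (intro integrable_of_square_integrable meas sq)
  show "has_bochner_integral M (\<lambda>\<omega>. x \<omega> $ i * cnj (x \<omega> $ j)) (if i = j then of_real 1 else 0)"
    if "j < n"
    unfolding has_bochner_integral_iff
    using int[OF assms(3) that] assms(3) that
    by (auto intro!: integrable_mult_of_square_integrable meas sq)
qed

text \<open>In \<open>e $ k * cnj (e $ l)\<close> the real part is the sum of two real covariances,
  hence the variance \<open>2 * v\<close>. The imaginary part consists of mixed products of real and
  imaginary parts, whose expectations vanish by independence and zero means.\<close>

lemma isotropic_complex_normal:
  assumes "v > 0"
    and e: "e \<in> M \<rightarrow>\<^sub>M vec_borel n"
    and Re: "distr M (vec_borel n) (\<lambda>\<omega>. map_vec Re (e \<omega>)) = isotropic_normal n v"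
    and Im: "distr M (vec_borel n) (\<lambda>\<omega>. map_vec Im (e \<omega>)) = isotropic_normal n v"
    and indep: "indep_var (vec_borel n) (\<lambda>\<omega>. map_vec Re (e \<omega>)) (vec_borel n) (\<lambda>\<omega>. map_vec Im (e \<omega>))"
    and "k < n"
  shows "has_bochner_integral M (\<lambda>\<omega>. e \<omega> $ k) 0"
    and "l < n \<Longrightarrow>
      has_bochner_integral M (\<lambda>\<omega>. e \<omega> $ k * cnj (e \<omega> $ l)) (if k = l then of_real (2 * v) else 0)"
proof -
  \<comment> \<open>Moments are transported from the law to the underlying space. The separate
    function \<open>h\<close> is needed because \<open>map_vec f u $ i\<close> equals
    \<open>f (u $ i)\<close> only for indices within the dimension.\<close>
  have pull: "has_bochner_integral M (\<lambda>\<omega>. h (e \<omega>)) c"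
    if "distr M (vec_borel n) (\<lambda>\<omega>. map_vec f (e \<omega>)) = isotropic_normal n v"
      and "(\<lambda>\<omega>. map_vec f (e \<omega>)) \<in> M \<rightarrow>\<^sub>M vec_borel n"
      and "g \<in> borel_measurable (vec_borel n)"
      and "has_bochner_integral (isotropic_normal n v) g c"
      and "\<And>u. u \<in> carrier_vec n \<Longrightarrow> g (map_vec f u) = h u"
    for f :: "complex \<Rightarrow> real" and g :: "real vec \<Rightarrow> real" and h c
  proof -
    have "has_bochner_integral M (\<lambda>\<omega>. g (map_vec f (e \<omega>))) c"
      using that(4) that(2,3) unfolding that(1)[symmetric]
      by (simp add: has_bochner_integral_iff integrable_distr_eq integral_distr)
    also have "has_bochner_integral M (\<lambda>\<omega>. g (map_vec f (e \<omega>))) c \<longleftrightarrow>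
        has_bochner_integral M (\<lambda>\<omega>. h (e \<omega>)) c"
      using measurable_space[OF e] by (intro has_bochner_integral_cong refl that(5)) simp
    finally show ?thesis .
  qed
  note rv = indep_var_rv1[OF indep] indep_var_rv2[OF indep]
  have mean: "has_bochner_integral M (\<lambda>\<omega>. Re (e \<omega> $ i)) 0" "has_bochner_integral M (\<lambda>\<omega>. Im (e \<omega> $ i)) 0"
    if "i < n" for i
    using pull[OF Re rv(1) measurable_vec_index[OF that] isotropic_normal_mean[OF \<open>v > 0\<close> that], of "\<lambda>u. Re (u $ i)"]
      pull[OF Im rv(2) measurable_vec_index[OF that] isotropic_normal_mean[OF \<open>v > 0\<close> that], of "\<lambda>u. Im (u $ i)"] that
    by simp_all
  have cov: "has_bochner_integral M (\<lambda>\<omega>. Re (e \<omega> $ i) * Re (e \<omega> $ j)) (if i = j then v else 0)"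
    "has_bochner_integral M (\<lambda>\<omega>. Im (e \<omega> $ i) * Im (e \<omega> $ j)) (if i = j then v else 0)"
    if "i < n" "j < n" for i j
  proof -
    note * = borel_measurable_times[OF measurable_vec_index[OF that(1)] measurable_vec_index[OF that(2)]]
      isotropic_normal_covariance[OF \<open>v > 0\<close> that]
    show "has_bochner_integral M (\<lambda>\<omega>. Re (e \<omega> $ i) * Re (e \<omega> $ j)) (if i = j then v else 0)"
      using that by (intro pull[OF Re rv(1) *]) auto
    show "has_bochner_integral M (\<lambda>\<omega>. Im (e \<omega> $ i) * Im (e \<omega> $ j)) (if i = j then v else 0)"
      using that by (intro pull[OF Im rv(2) *]) auto
  qed
  have cross: "has_bochner_integral M (\<lambda>\<omega>. Re (e \<omega> $ i) * Im (e \<omega> $ j)) 0" if "i < n" "j < n" for i j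
  proof -
    have "indep_var borel (\<lambda>\<omega>. map_vec Re (e \<omega>) $ i) borel (\<lambda>\<omega>. map_vec Im (e \<omega>) $ j)"
      using indep_var_compose[OF indep measurable_vec_index[OF that(1)] measurable_vec_index[OF that(2)]]
      by (simp add: comp_def)
    moreover have "has_bochner_integral M (\<lambda>\<omega>. map_vec Re (e \<omega>) $ i) 0"
      by (rule pull[OF Re rv(1) measurable_vec_index[OF that(1)] isotropic_normal_mean[OF \<open>v > 0\<close> that(1)]]) simp
    moreover have "has_bochner_integral M (\<lambda>\<omega>. map_vec Im (e \<omega>) $ j) 0"
      by (rule pull[OF Im rv(2) measurable_vec_index[OF that(2)] isotropic_normal_mean[OF \<open>v > 0\<close> that(2)]]) simp
    ultimately have "has_bochner_integral M (\<lambda>\<omega>. map_vec Re (e \<omega>) $ i * map_vec Im (e \<omega>) $ j) 0"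
      by (simp add: has_bochner_integral_iff indep_var_integrable indep_var_lebesgue_integral)
    also have "has_bochner_integral M (\<lambda>\<omega>. map_vec Re (e \<omega>) $ i * map_vec Im (e \<omega>) $ j) 0 \<longleftrightarrow>
        has_bochner_integral M (\<lambda>\<omega>. Re (e \<omega> $ i) * Im (e \<omega> $ j)) 0"
      using measurable_space[OF e] that by (intro has_bochner_integral_cong refl) fastforce
    finally show ?thesis .
  qed
  have "has_bochner_integral M (\<lambda>\<omega>. of_real (Re (e \<omega> $ k)) + \<i> * of_real (Im (e \<omega> $ k))) (of_real 0 + \<i> * of_real 0)"
    by (intro has_bochner_integral_add has_bochner_integral_mult_right has_bochner_integral_of_real mean \<open>k < n\<close>)
  then show "has_bochner_integral M (\<lambda>\<omega>. e \<omega> $ k) 0"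
    by (simp flip: complex_eq)
  assume l: "l < n"
  let ?d = "if k = l then v else 0"
  have "has_bochner_integral M
      (\<lambda>\<omega>. of_real (Re (e \<omega> $ k) * Re (e \<omega> $ l) + Im (e \<omega> $ k) * Im (e \<omega> $ l)) +
        \<i> * of_real (Re (e \<omega> $ l) * Im (e \<omega> $ k) - Re (e \<omega> $ k) * Im (e \<omega> $ l)))
      (of_real (?d + ?d) + \<i> * of_real (0 - 0))"
    by (intro has_bochner_integral_add has_bochner_integral_diff has_bochner_integral_mult_right
        has_bochner_integral_of_real cov cross \<open>k < n\<close> l)
  also have "(\<lambda>\<omega>. of_real (Re (e \<omega> $ k) * Re (e \<omega> $ l) + Im (e \<omega> $ k) * Im (e \<omega> $ l)) +
        \<i> * of_real (Re (e \<omega> $ l) * Im (e \<omega> $ k) - Re (e \<omega> $ k) * Im (e \<omega> $ l))) =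
      (\<lambda>\<omega>. e \<omega> $ k * cnj (e \<omega> $ l))"
    by (auto simp: complex_eq_iff)
  also have "of_real (?d + ?d) + \<i> * of_real (0 - 0) = (if k = l then of_real (2 * v) else 0)"
    by simp
  finally show "has_bochner_integral M (\<lambda>\<omega>. e \<omega> $ k * cnj (e \<omega> $ l))
      (if k = l then of_real (2 * v) else 0)" .
qed

text \<open>The coordinates of \<open>x\<close> and \<open>e\<close> are stacked into one orthogonal
  family over a disjoint sum of index sets, with second moments 1 and \<open>s\<close>. Each output
  coordinate is a linear combination of it, so Pythagoras applies row by row.\<close>

lemma expectation_l2_norm_square_linear:
  fixes B C :: "complex mat"
  assumes x: "x \<in> M \<rightarrow>\<^sub>M vec_borel n" and e: "e \<in> M \<rightarrow>\<^sub>M vec_borel m"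
    and x2: "second_moment M n x = 1\<^sub>m n"
    and e1: "\<And>k. k < m \<Longrightarrow> has_bochner_integral M (\<lambda>\<omega>. e \<omega> $ k) 0"
    and e2: "\<And>k l. k < m \<Longrightarrow> l < m \<Longrightarrow>
      has_bochner_integral M (\<lambda>\<omega>. e \<omega> $ k * cnj (e \<omega> $ l)) (if k = l then of_real s else 0)"
    and indep: "indep_var (vec_borel n) x (vec_borel m) e"
    and B: "B \<in> carrier_mat p n" and C: "C \<in> carrier_mat p m"
  shows "expectation (\<lambda>\<omega>. (l2_norm (B *\<^sub>v x \<omega> + C *\<^sub>v e \<omega>))\<^sup>2) =
    (\<Sum>j<p. (\<Sum>k<n. (cmod (B $$ (j, k)))\<^sup>2) + s * (\<Sum>l<m. (cmod (C $$ (j, l)))\<^sup>2))"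
proof -
  let ?I = "{..<n} <+> {..<m}"
  let ?z = "\<lambda>i \<omega>. case i of Inl k \<Rightarrow> x \<omega> $ k | Inr l \<Rightarrow> e \<omega> $ l"
  let ?d = "\<lambda>i. case i of Inl k \<Rightarrow> 1 | Inr l \<Rightarrow> s"
  let ?c = "\<lambda>j i. case i of Inl k \<Rightarrow> B $$ (j, k) | Inr l \<Rightarrow> C $$ (j, l)"
  \<comment> \<open>Independence factors the expectation, and the factor coming from
    \<open>e\<close> is 0.\<close>
  have cross: "has_bochner_integral M (\<lambda>\<omega>. x \<omega> $ k * cnj (e \<omega> $ l)) 0" if "k < n" "l < m" for k l
  proof -
    have "(\<lambda>v. cnj (v $ l)) \<in> borel_measurable (vec_borel m)"
      by (intro borel_measurable_cnj measurable_vec_index that)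
    from indep_var_compose[OF indep measurable_vec_index[OF that(1)] this]
    have "indep_var borel (\<lambda>\<omega>. x \<omega> $ k) borel (\<lambda>\<omega>. cnj (e \<omega> $ l))"
      by (simp add: comp_def)
    then show ?thesis
      using second_moment_oneD(2)[OF x x2 that(1)] e1[OF that(2)]
      by (simp add: has_bochner_integral_iff indep_var_integrable indep_var_lebesgue_integral)
  qed
  have orth: "has_bochner_integral M (\<lambda>\<omega>. ?z i \<omega> * cnj (?z j \<omega>)) (if i = j then of_real (?d i) else 0)"
    if "i \<in> ?I" "j \<in> ?I" for i j
  proof (cases i; cases j)
    fix k l assume "i = Inl k" "j = Inl l"
    then show ?thesis using that second_moment_oneD(3)[OF x x2, of k l] by auto
  next
    fix k l assume "i = Inl k" "j = Inr l"
    then show ?thesis using that cross[of k l] by auto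
  next
    fix k l assume "i = Inr k" "j = Inl l"
    then show ?thesis using that has_bochner_integral_cnj[OF cross[of l k]] by (auto simp: mult.commute)
  next
    fix k l assume "i = Inr k" "j = Inr l"
    then show ?thesis using that e2[of k l] by auto
  qed
  have comp: "(l2_norm (B *\<^sub>v x \<omega> + C *\<^sub>v e \<omega>))\<^sup>2 = (\<Sum>j<p. (cmod (\<Sum>i\<in>?I. ?c j i * ?z i \<omega>))\<^sup>2)"
    if "\<omega> \<in> space M" for \<omega>
  proof -
    have "x \<omega> \<in> carrier_vec n" "e \<omega> \<in> carrier_vec m"
      using measurable_space[OF x that] measurable_space[OF e that] by simp_all
    then show ?thesis
      using B C by (auto simp: l2_norm_power2 sum.Plus scalar_prod_def lessThan_atLeast0 comp_def intro!: sum.cong)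
  qed
  have "has_bochner_integral M (\<lambda>\<omega>. \<Sum>j<p. (cmod (\<Sum>i\<in>?I. ?c j i * ?z i \<omega>))\<^sup>2)
      (\<Sum>j<p. \<Sum>i\<in>?I. (cmod (?c j i))\<^sup>2 * ?d i)"
    by (intro has_bochner_integral_sum has_bochner_integral_norm_square_orthogonal orth) auto
  then have "expectation (\<lambda>\<omega>. \<Sum>j<p. (cmod (\<Sum>i\<in>?I. ?c j i * ?z i \<omega>))\<^sup>2) =
      (\<Sum>j<p. \<Sum>i\<in>?I. (cmod (?c j i))\<^sup>2 * ?d i)"
    by (rule has_bochner_integral_integral_eq)
  also have "expectation (\<lambda>\<omega>. \<Sum>j<p. (cmod (\<Sum>i\<in>?I. ?c j i * ?z i \<omega>))\<^sup>2) =
      expectation (\<lambda>\<omega>. (l2_norm (B *\<^sub>v x \<omega> + C *\<^sub>v e \<omega>))\<^sup>2)"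
    by (intro Bochner_Integration.integral_cong refl comp[symmetric])
  finally show ?thesis
    by (simp add: sum.Plus comp_def sum_distrib_left mult.commute)
qed

end

section \<open>The reconstruction error\<close>

lemma sum_residue_projection_defect:
  assumes "j < N"
  shows "(\<Sum>k<N. (cmod ((if j mod m = k mod m then 1 / of_nat (residue_count m N j) else 0) -
      (if j = k then 1 else 0)))\<^sup>2) = 1 - 1 / real (residue_count m N j)"
proof -
  let ?n = "real (residue_count m N j)"
  have n: "?n > 0"
    using residue_count_pos[OF assms] by simp
  \<comment> \<open>The row of the averaging matrix has \<open>?n\<close> entries
    \<open>1 / ?n\<close>, and subtracting the identity changes only the diagonal one: its square
    \<open>(1 / ?n - 1)^2\<close> exceeds \<open>1 / ?n^2\<close> by \<open>1 - 2 / ?n\<close>.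
    Summation gives \<open>1 / ?n + 1 - 2 / ?n\<close>.\<close>
  have "(cmod ((if j mod m = k mod m then 1 / of_nat (residue_count m N j) else 0) -
        (if j = k then 1 else 0)))\<^sup>2 =
      (if k mod m = j mod m then 1 / ?n\<^sup>2 else 0) + (if k = j then 1 - 2 / ?n else 0)" for k
  proof (cases "k = j")
    case True
    have "cmod (1 / of_nat (residue_count m N j) - 1) = \<bar>1 / ?n - 1\<bar>"
      by (metis norm_of_real of_real_1 of_real_diff of_real_divide of_real_of_nat_eq)
    then have "(cmod (1 / of_nat (residue_count m N j) - 1))\<^sup>2 = (1 / ?n - 1)\<^sup>2"
      by (simp only: power2_abs)
    also have "\<dots> = 1 / ?n\<^sup>2 + (1 - 2 / ?n)"
      by (simp add: power2_diff power_divide)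
    finally show ?thesis
      using True by simp
  next
    case False
    then show ?thesis by (auto simp: norm_divide power_divide)
  qed
  then have "(\<Sum>k<N. (cmod ((if j mod m = k mod m then 1 / of_nat (residue_count m N j) else 0) -
        (if j = k then 1 else 0)))\<^sup>2) =
      (\<Sum>k<N. if k mod m = j mod m then 1 / ?n\<^sup>2 else 0) + (\<Sum>k<N. if k = j then 1 - 2 / ?n else 0)"
    by (simp add: sum.distrib)
  also have "(\<Sum>k<N. if k mod m = j mod m then 1 / ?n\<^sup>2 else 0) = ?n * (1 / ?n\<^sup>2)"
    by (simp add: sum.If_cases Int_def residue_count_def)
  also have "(\<Sum>k<N. if k = j then 1 - 2 / ?n else 0) = 1 - 2 / ?n"
    using assms by simp
  finally show ?thesis
    using n by (simp add: power2_eq_square)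
qed

theorem theorem10:
  fixes q m N a b :: nat
    and A :: "complex mat"
    and \<epsilon> :: real
    and M :: "'w measure"
    and x e y xhat :: "'w \<Rightarrow> complex vec"
  assumes "m \<ge> 1"
    and "N = 2 * q + 1"
    and "A = fourier_matrix q m"
    and "a = N div m" and "N = a * m + b" and "b < m"
    and "\<epsilon> > 0"
    and "prob_space M"
    and "x \<in> measurable M (vec_borel N)"
    and "second_moment M N x = 1\<^sub>m N"
    and "e \<in> measurable M (vec_borel m)"
    and "distr M (vec_borel m) (\<lambda>\<omega>. map_vec Re (e \<omega>)) = isotropic_normal m (\<epsilon>\<^sup>2 / (2 * real m))"
    and "distr M (vec_borel m) (\<lambda>\<omega>. map_vec Im (e \<omega>)) = isotropic_normal m (\<epsilon>\<^sup>2 / (2 * real m))"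
    and "prob_space.indep_var M (vec_borel m) (\<lambda>\<omega>. map_vec Re (e \<omega>))
           (vec_borel m) (\<lambda>\<omega>. map_vec Im (e \<omega>))"
    and "prob_space.indep_var M (vec_borel N) x (vec_borel m) e"
    and "\<And>\<omega>. \<omega> \<in> space M \<Longrightarrow> y \<omega> = A *\<^sub>v x \<omega> + e \<omega>"
    and "\<And>\<omega>. \<omega> \<in> space M \<Longrightarrow> xhat \<omega> = moore_penrose A *\<^sub>v y \<omega>"
  shows "prob_space.expectation M (\<lambda>\<omega>. (l2_norm (xhat \<omega> - x \<omega>))\<^sup>2) =
    (if m \<ge> N then real N / (real m)\<^sup>2 * \<epsilon>\<^sup>2
     else (real m + real N - 2 * real b) / (real a * (real a + 1) * (real m)\<^sup>2) * \<epsilon>\<^sup>2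
            + real N - real m)"
proof -
  interpret prob_space M by fact
  let ?P = "fourier_pinv q m"
  let ?B = "?P * A - 1\<^sub>m N"
  let ?n = "\<lambda>j. real (residue_count m N j)"
  have m: "m > 0" using assms(1) by simp
  have A: "A \<in> carrier_mat m N" and P: "?P \<in> carrier_mat N m"
    using assms(2,3) fourier_matrix_carrier fourier_pinv_carrier by auto
  have PA: "?P * A \<in> carrier_mat N N" by (rule mult_carrier_mat[OF P A])
  have pinv: "moore_penrose A = ?P"
    unfolding assms(3) by (rule moore_penrose_eqI[OF is_moore_penrose_fourier_pinv[OF m]])
  have error: "xhat \<omega> - x \<omega> = ?B *\<^sub>v x \<omega> + ?P *\<^sub>v e \<omega>" if "\<omega> \<in> space M" for \<omega>
  proof -
    have x: "x \<omega> \<in> carrier_vec N" and e: "e \<omega> \<in> carrier_vec m"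
      using measurable_space[OF assms(9) that] measurable_space[OF assms(11) that] by simp_all
    have "xhat \<omega> = ?P *\<^sub>v (A *\<^sub>v x \<omega>) + ?P *\<^sub>v e \<omega>"
      using mult_add_distrib_mat_vec[OF P mult_mat_vec_carrier[OF A x] e]
      by (simp add: assms(16,17) that pinv)
    also have "?P *\<^sub>v (A *\<^sub>v x \<omega>) = (?P * A) *\<^sub>v x \<omega>"
      using assoc_mult_mat_vec[OF P A x] by simp
    finally have "xhat \<omega> - x \<omega> = ((?P * A) *\<^sub>v x \<omega> - 1\<^sub>m N *\<^sub>v x \<omega>) + ?P *\<^sub>v e \<omega>"
      using x e P PA by (intro eq_vecI) auto
    also have "(?P * A) *\<^sub>v x \<omega> - 1\<^sub>m N *\<^sub>v x \<omega> = ?B *\<^sub>v x \<omega>"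
      using minus_mult_distrib_mat_vec[OF PA one_carrier_mat x] by simp
    finally show ?thesis .
  qed
  have v: "\<epsilon>\<^sup>2 / (2 * real m) > 0"
    using assms(7) m by simp
  note e_moments = isotropic_complex_normal[OF v assms(11,12,13,14)]
  have "expectation (\<lambda>\<omega>. (l2_norm (xhat \<omega> - x \<omega>))\<^sup>2) =
      expectation (\<lambda>\<omega>. (l2_norm (?B *\<^sub>v x \<omega> + ?P *\<^sub>v e \<omega>))\<^sup>2)"
    by (intro Bochner_Integration.integral_cong refl) (simp only: error)
  \<comment> \<open>The real and imaginary parts each have variance
    \<open>\<epsilon>^2 / (2 * m)\<close>, so the complex noise coordinates have second moment twice
    that.\<close>
  also have "\<dots> = (\<Sum>j<N. (\<Sum>k<N. (cmod (?B $$ (j, k)))\<^sup>2) +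
      2 * (\<epsilon>\<^sup>2 / (2 * real m)) * (\<Sum>l<m. (cmod (?P $$ (j, l)))\<^sup>2))"
    by (rule expectation_l2_norm_square_linear[OF assms(9,11,10) e_moments assms(15) _ P])
      (use PA in \<open>auto intro: minus_carrier_mat\<close>)
  also have "\<dots> = (\<Sum>j<N. 1 - 1 / ?n j + \<epsilon>\<^sup>2 / (real m)\<^sup>2 * (1 / (?n j)\<^sup>2))"
  proof (rule sum.cong[OF refl])
    fix j assume "j \<in> {..<N}"
    then have j: "j < N" by simp
    have "(\<Sum>k<N. (cmod (?B $$ (j, k)))\<^sup>2) =
        (\<Sum>k<N. (cmod ((if j mod m = k mod m then 1 / of_nat (residue_count m N j) else 0) -
          (if j = k then 1 else 0)))\<^sup>2)"
      using j PA unfolding assms(3) fourier_pinv_mult[OF m] assms(2)[symmetric]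
      by (intro sum.cong) auto
    also have "\<dots> = 1 - 1 / ?n j"
      by (rule sum_residue_projection_defect[OF j])
    finally have B: "(\<Sum>k<N. (cmod (?B $$ (j, k)))\<^sup>2) = 1 - 1 / ?n j" .
    have "(\<Sum>l<m. (cmod (?P $$ (j, l)))\<^sup>2) = (\<Sum>l<m. 1 / (real m * ?n j)\<^sup>2)"
    proof (rule sum.cong[OF refl])
      fix l assume "l \<in> {..<m}"
      then have "cmod (?P $$ (j, l)) = 1 / (real m * ?n j)"
        using j norm_fourier_matrix[of l m j q] assms(2)
        by (simp add: fourier_pinv_def norm_divide norm_mult)
      then show "(cmod (?P $$ (j, l)))\<^sup>2 = 1 / (real m * ?n j)\<^sup>2"
        by (simp add: power_divide)
    qed
    also have "\<dots> = 1 / (real m * (?n j)\<^sup>2)"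
      using m by (simp add: power2_eq_square)
    finally have "2 * (\<epsilon>\<^sup>2 / (2 * real m)) * (\<Sum>l<m. (cmod (?P $$ (j, l)))\<^sup>2) =
        \<epsilon>\<^sup>2 / (real m)\<^sup>2 * (1 / (?n j)\<^sup>2)"
      by (simp add: power2_eq_square)
    with B show "(\<Sum>k<N. (cmod (?B $$ (j, k)))\<^sup>2) +
        2 * (\<epsilon>\<^sup>2 / (2 * real m)) * (\<Sum>l<m. (cmod (?P $$ (j, l)))\<^sup>2) =
        1 - 1 / ?n j + \<epsilon>\<^sup>2 / (real m)\<^sup>2 * (1 / (?n j)\<^sup>2)" by simp
  qed
  also have "\<dots> = real N - (\<Sum>j<N. 1 / ?n j) + \<epsilon>\<^sup>2 / (real m)\<^sup>2 * (\<Sum>j<N. 1 / (?n j)\<^sup>2)"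
    by (simp add: sum.distrib sum_subtractf sum_distrib_left)
  also have "\<dots> = (if m \<ge> N then real N / (real m)\<^sup>2 * \<epsilon>\<^sup>2
     else (real m + real N - 2 * real b) / (real a * (real a + 1) * (real m)\<^sup>2) * \<epsilon>\<^sup>2
            + real N - real m)"
  proof (cases "m \<ge> N")
    \<comment> \<open>Every class is a singleton, so the signal part vanishes and each of the
      \<open>N\<close> noise terms is the same.\<close>
    case True
    then show ?thesis by (simp add: residue_count_eq_1)
  next
    case False
    then have a: "a > 0" using assms(4) m by (simp add: div_greater_zero_iff)
    \<comment> \<open>As \<open>a > 0\<close>, no class is empty; each one contributes 1, so the sum
      counts the \<open>m\<close> classes. This produces \<open>N - m\<close>.\<close>
    have "(\<Sum>j<N. 1 / ?n j) = real m"
      using sum_inverse_residue_count[OF assms(6) a, of 0] assms(5,6) by simp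
    moreover have "(\<Sum>j<N. 1 / (?n j)\<^sup>2) = real (m - b) / real a + real b / (real a + 1)"
      using sum_inverse_residue_count[OF assms(6) a, of 1] unfolding assms(5)[symmetric]
      by (simp add: numeral_2_eq_2)
    \<comment> \<open>Over the common denominator the numerator is
      \<open>(m - b) * (a + 1) + b * a = a * m + m - b\<close>, and
      \<open>a * m = N - b\<close>.\<close>
    moreover have "real (m - b) / real a + real b / (real a + 1) =
        (real m + real N - 2 * real b) / (real a * (real a + 1))"
      using a assms(6) by (simp add: assms(5) of_nat_diff field_simps)
    ultimately show ?thesis
      using False by (simp add: mult_ac)
  qed
  finally show ?thesis .
qed

end
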